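(* Let $k\in\mathbb N$, $m_1,\dots,m_k\in\mathbb N$ and $b_1,\dots,b_k\in\mathbb R\setminus\{0\}$. For $z\in\mathbb C$ consider the nested integral $f(z)=I_{m_1,m_2,\ldots,m_k}(b_1,b_2,\ldots,b_k;z)$ defined in the context. Then $f(2z)$ and $f(2z+1)$ (with the powers of negative numbers interpreted as explained in the context) are functions of $z$ of C-type.
   Context: $\mathbb N=\{1,2,\dots\}$. C-type: a function $f:M\to\mathbb C$ on a region $M\subset\mathbb C$ is of Carlson-type (C-type) if (i) it is analytic in the right half plane $\{\operatorname{Re}(z)\ge 0\}$; (ii) it is of exponential type there, i.e. there exist real $c,C>0$ with $|f(z)|\le C e^{c|z|}$ for all $z$ with $\operatorname{Re}(z)\ge0$; (iii) there exist real $c,C>0$ with $c<\pi$ such that $|f(iy)|\le Ce^{c|y|}$ for all $y\in\mathbb R$. Nested integral: put $B_0=1$ and $B_j=b_1b_2\cdots b_j$ for $1\le j\le k$, and let $F_0(x)=x^z-1$. For $j=1,\dots,k$ define $$g_{j,1}(u)=\frac{F_{j-1}(u)}{u-B_{j-1}},\qquad g_{j,i}(u)=\frac1u\int_0^u g_{j,i-1}(t)\,dt\quad(2\le i\le m_j),$$ $$F_j(x)=\int_{B_j}^{x}g_{j,m_j}(u)\,du ,$$ and finally $$I_{m_1,\ldots,m_k}(b_1,\ldots,b_k;z)=\int_0^{b_1\cdots b_k}g_{k,m_k}(u)\,du.$$ (The singularities at $u=B_{j-1}$ are removable.) Convention for negative integration variables: the integration range may contain negative $x$. For integer $n$ one writes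 $x^n=(-1)^n(-x)^n$ when $x<0$, and uses $(-1)^{2n}=1$, $(-1)^{2n+1}=-1$. Accordingly, $f(2z)$ is the function $\int_0^{b_1\cdots b_k}g_{k,m_k}(u)\,du$ obtained when the functions $g_{j,i}$ and $F_j$ ($1\le j\le k$) are defined by the same recursive formulas $g_{j,1}(u)=F_{j-1}(u)/(u-B_{j-1})$, $g_{j,i}(u)=\frac1u\int_0^u g_{j,i-1}(t)\,dt$, $F_j(x)=\int_{B_j}^x g_{j,m_j}(u)\,du$, but starting from $F_0(x)=x^{2z}-1$ for $x>0$ and $F_0(x)=(-x)^{2z}-1$ for $x<0$; and $f(2z+1)$ is the function obtained by these same formulas starting from $F_0(x)=x^{2z+1}-1$ for $x>0$ and $F_0(x)=-(-x)^{2z+1}-1$ for $x<0$. *)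

theory Defs
  imports "HOL-Complex_Analysis.Complex_Analysis"
begin

text \<open>
  Analyticity on the closed half plane means holomorphy in a neighbourhood of each of its points
  (the function is given on a larger region).
\<close>

definition carlson_type :: "(complex \<Rightarrow> complex) \<Rightarrow> bool" where
  "carlson_type f \<longleftrightarrow>
     f analytic_on {z. Re z \<ge> 0} \<and>
     (\<exists>c C :: real. c > 0 \<and> C > 0 \<and> (\<forall>z. Re z \<ge> 0 \<longrightarrow> norm (f z) \<le> C * exp (c * norm z))) \<and>
     (\<exists>c C :: real. c > 0 \<and> C > 0 \<and> c < pi \<and>
        (\<forall>y::real. norm (f (\<i> * of_real y)) \<le> C * exp (c * \<bar>y\<bar>)))"

definition bprod :: "(nat \<Rightarrow> real) \<Rightarrow> nat \<Rightarrow> real" where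
  "bprod b j = (\<Prod>i=1..j. b i)"

text \<open>
  \<open>nested_g F B i\<close> is \<open>g\<^sub>j\<^sub>,\<^sub>i\<close>, where \<open>F = F\<^sub>j\<^sub>-\<^sub>1\<close> and \<open>B = B\<^sub>j\<^sub>-\<^sub>1\<close>. The index \<open>i\<close> starts at 1;
  the value at \<open>i = 0\<close> is a dummy. At \<open>u = B\<close> (a removable singularity) and at \<open>u = 0\<close>
  division by zero yields the value 0; these single points have measure zero and do not
  affect any integral. The same holds for the value of \<open>F\<^sub>0\<close> at 0.
  All integrals are oriented Lebesgue integrals, so the upper limit may be below the lower one.
\<close>

fun nested_g :: "(real \<Rightarrow> complex) \<Rightarrow> real \<Rightarrow> nat \<Rightarrow> real \<Rightarrow> complex" where
  "nested_g F B 0 u = 0"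
| "nested_g F B (Suc 0) u = F u / of_real (u - B)"
| "nested_g F B (Suc (Suc i)) u =
     1 / of_real u * (LBINT t=ereal 0..ereal u. nested_g F B (Suc i) t)"

primrec nested_F ::
  "(real \<Rightarrow> complex) \<Rightarrow> (nat \<Rightarrow> nat) \<Rightarrow> (nat \<Rightarrow> real) \<Rightarrow> nat \<Rightarrow> real \<Rightarrow> complex" where
  "nested_F F0 m b 0 = F0"
| "nested_F F0 m b (Suc j) =
     (\<lambda>x. LBINT u=ereal (bprod b (Suc j))..ereal x.
            nested_g (nested_F F0 m b j) (bprod b j) (m (Suc j)) u)"

text \<open>The sequences \<open>m\<close> and \<open>b\<close> are indexed from 1; only the entries 1 to \<open>k\<close> are used.\<close>

definition nested_integral ::
  "(real \<Rightarrow> complex) \<Rightarrow> nat \<Rightarrow> (nat \<Rightarrow> nat) \<Rightarrow> (nat \<Rightarrow> real) \<Rightarrow> complex" where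
  "nested_integral F0 k m b =
     (LBINT u=ereal 0..ereal (bprod b k).
        nested_g (nested_F F0 m b (k - 1)) (bprod b (k - 1)) (m k) u)"

text \<open>
  The integral \<open>I\<close> with \<open>F\<^sub>0(x) = x\<^sup>z - 1\<close>. For negative \<open>x\<close> the library power is the
  principal branch, which is not the convention wanted here; \<open>I_even\<close> and \<open>I_odd\<close> below
  are \<open>f(2z)\<close> and \<open>f(2z+1)\<close> with the intended powers, extending \<open>I_nested k m b (2 * z)\<close> and
  \<open>I_nested k m b (2 * z + 1)\<close> from positive \<open>b\<close> to arbitrary signs (\<open>I_even_pos\<close>, \<open>I_odd_pos\<close>).
\<close>

definition I_nested :: "nat \<Rightarrow> (nat \<Rightarrow> nat) \<Rightarrow> (nat \<Rightarrow> real) \<Rightarrow> complex \<Rightarrow> complex" where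
  "I_nested k m b z = nested_integral (\<lambda>x. of_real x powr z - 1) k m b"

definition even_powr :: "real \<Rightarrow> complex \<Rightarrow> complex" where
  "even_powr x w = (if x > 0 then of_real x powr w else of_real (- x) powr w)"

definition odd_powr :: "real \<Rightarrow> complex \<Rightarrow> complex" where
  "odd_powr x w = (if x > 0 then of_real x powr w else - (of_real (- x) powr w))"

definition I_even :: "nat \<Rightarrow> (nat \<Rightarrow> nat) \<Rightarrow> (nat \<Rightarrow> real) \<Rightarrow> complex \<Rightarrow> complex" where
  "I_even k m b z = nested_integral (\<lambda>x. even_powr x (2 * z) - 1) k m b"

definition I_odd :: "nat \<Rightarrow> (nat \<Rightarrow> nat) \<Rightarrow> (nat \<Rightarrow> real) \<Rightarrow> complex \<Rightarrow> complex" where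
  "I_odd k m b z = nested_integral (\<lambda>x. odd_powr x (2 * z + 1) - 1) k m b"

lemma even_powr_of_nat:
  assumes "x \<noteq> 0"
  shows "even_powr x (2 * of_nat n) = of_real (x ^ (2 * n))"
proof -
  have "(of_real y :: complex) powr (2 * of_nat n) = of_real (y ^ (2 * n))" if "y \<noteq> 0" for y :: real
    using powr_nat'[of "of_real y :: complex" "2 * n"] that by simp
  from this[of x] this[of "- x"] assms show ?thesis
    by (simp add: even_powr_def)
qed

lemma odd_powr_of_nat:
  assumes "x \<noteq> 0"
  shows "odd_powr x (2 * of_nat n + 1) = of_real (x ^ (2 * n + 1))"
proof -
  have "(of_real y :: complex) powr (2 * of_nat n + 1) = of_real (y ^ (2 * n + 1))"
    if "y \<noteq> 0" for y :: real
    using powr_nat'[of "of_real y :: complex" "2 * n + 1"] that by (simp add: add.commute)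
  from this[of x] this[of "- x"] assms show ?thesis
    by (simp add: odd_powr_def)
qed

lemma nested_g_cong_pos:
  assumes "\<And>x. x > 0 \<Longrightarrow> F x = G x" "u > 0"
  shows "nested_g F B i u = nested_g G B i u"
  using assms(2)
proof (induction i arbitrary: u)
  case (Suc i)
  show ?case
  proof (cases i)
    case 0
    with Suc.prems assms(1) show ?thesis by simp
  next
    case (Suc i')
    have "(LBINT t=ereal 0..ereal u. nested_g F B i t) =
          (LBINT t=ereal 0..ereal u. nested_g G B i t)"
      using Suc.IH Suc.prems by (intro interval_integral_cong) (auto simp: einterval_def)
    with Suc show ?thesis by simp
  qed
qed simp

lemma nested_F_cong_pos:
  assumes "\<And>x. x > 0 \<Longrightarrow> F x = G x" and "\<And>i. i \<in> {1..j} \<Longrightarrow> b i > 0" and "x > 0"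
  shows "nested_F F m b j x = nested_F G m b j x"
  using assms(2,3)
proof (induction j arbitrary: x)
  case (Suc j)
  have "bprod b (Suc j) > 0"
    unfolding bprod_def using Suc.prems(1) by (intro prod_pos) auto
  moreover have "nested_g (nested_F F m b j) B i u = nested_g (nested_F G m b j) B i u"
    if "u > 0" for B i u
    using that Suc.IH Suc.prems(1) by (intro nested_g_cong_pos) auto
  ultimately show ?case
    using Suc.prems(2)
    by (auto intro!: interval_integral_cong simp: einterval_def min_def split: if_splits)
qed (use assms(1) in auto)

lemma nested_integral_cong_pos:
  assumes "\<And>x. x > 0 \<Longrightarrow> F x = G x" and "\<And>i. i \<in> {1..k} \<Longrightarrow> b i > 0"
  shows "nested_integral F k m b = nested_integral G k m b"
proof -
  have "bprod b k > 0"
    unfolding bprod_def using assms(2) by (intro prod_pos) auto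
  moreover have "nested_g (nested_F F m b (k - 1)) B i u = nested_g (nested_F G m b (k - 1)) B i u"
    if "u > 0" for B i u
    using that assms by (intro nested_g_cong_pos nested_F_cong_pos) auto
  ultimately show ?thesis
    unfolding nested_integral_def
    by (auto intro!: interval_integral_cong simp: einterval_def min_def split: if_splits)
qed

lemma I_even_pos:
  assumes "\<And>i. i \<in> {1..k} \<Longrightarrow> b i > 0"
  shows "I_even k m b z = I_nested k m b (2 * z)"
  unfolding I_even_def I_nested_def
  by (rule nested_integral_cong_pos) (use assms in \<open>auto simp: even_powr_def\<close>)

lemma I_odd_pos:
  assumes "\<And>i. i \<in> {1..k} \<Longrightarrow> b i > 0"
  shows "I_odd k m b z = I_nested k m b (2 * z + 1)"
  unfolding I_odd_def I_nested_def
  by (rule nested_integral_cong_pos) (use assms in \<open>auto simp: odd_powr_def\<close>)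

end

theory Submission
  imports Defs
begin

text \<open>
  Both recursive steps, \<open>g\<^sub>j\<^sub>,\<^sub>i\<^sub>-\<^sub>1 \<mapsto> g\<^sub>j\<^sub>,\<^sub>i\<close> and \<open>g\<^sub>j\<^sub>,\<^sub>m \<mapsto> F\<^sub>j(u)/(u - B\<^sub>j) = g\<^sub>j\<^sub>+\<^sub>1\<^sub>,\<^sub>1\<close>, replace
  \<open>g\<close> by its mean value on the segment between a point \<open>c\<close> (namely \<open>0\<close> or \<open>B\<^sub>j\<close>) and \<open>u\<close>. Hence a bound for
  \<open>g\<^sub>1\<^sub>,\<^sub>1(u) = (u\<^sup>w - 1)/(u - 1)\<close> that is uniform in \<open>\<bar>u\<bar> \<le> R\<close> passes unchanged to all later functions, and
  growth in \<open>w\<close> on the closed half plane need only be estimated for \<open>g\<^sub>1\<^sub>,\<^sub>1\<close>. For holomorphy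
  across the imaginary axis one admits \<open>Re w > -1/2\<close> and carries along a bound \<open>\<bar>g(u)\<bar> \<le> C \<bar>u\<bar>\<^sup>-\<^sup>1\<^sup>/\<^sup>2\<close>, locally
  uniform in \<open>w\<close>: it is integrable, so that integrals are holomorphic by dominated convergence, and averaging
  preserves it up to a factor 3, whatever \<open>c\<close> is.
\<close>

section \<open>Holomorphy of integrals depending on a complex parameter\<close>

text \<open>Cauchy's inequality on discs of radius \<open>r / 3\<close> bounds
  \<open>deriv g\<close> on the smaller ball. The result dominates difference quotients under an
  integral.\<close>

lemma holomorphic_lipschitz_of_bounded:
  fixes g :: "complex \<Rightarrow> complex"
  assumes holo: "g holomorphic_on ball z0 r" and "r > 0"
    and bound: "\<And>z. z \<in> ball z0 r \<Longrightarrow> norm (g z) \<le> B"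
    and z: "z \<in> ball z0 (r / 3)"
  shows "norm (g z - g z0) \<le> (3 * B / r) * norm (z - z0)"
proof (rule field_differentiable_bound[where S = "ball z0 (r / 3)" and f' = "deriv g"])
  fix w assume w: "w \<in> ball z0 (r / 3)"
  have sub: "cball w (r / 3) \<subseteq> ball z0 r"
  proof
    fix v assume "v \<in> cball w (r / 3)"
    then show "v \<in> ball z0 r"
      using w \<open>r > 0\<close> dist_triangle[of z0 v w] by (simp add: dist_commute)
  qed
  have "norm ((deriv ^^ 1) g w) \<le> fact 1 * B / (r / 3) ^ 1"
  proof (rule Cauchy_inequality)
    show "g holomorphic_on ball w (r / 3)"
      using holo sub by (meson ball_subset_cball holomorphic_on_subset subset_trans)
    show "continuous_on (cball w (r / 3)) g"
      using holo sub by (meson holomorphic_on_imp_continuous_on holomorphic_on_subset)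
    show "norm (g x) \<le> B" if "norm (w - x) = r / 3" for x
      using bound sub that by (auto simp: subset_iff dist_norm)
  qed (use \<open>r > 0\<close> in simp)
  then show "norm (deriv g w) \<le> 3 * B / r"
    by (simp add: mult.commute)
  show "(g has_field_derivative deriv g w) (at w within ball z0 (r / 3))"
    using holo w \<open>r > 0\<close>
    by (intro DERIV_subset[OF holomorphic_derivI[OF holo open_ball]]) auto
qed (use z \<open>r > 0\<close> in auto)

text \<open>The Lipschitz bound dominates the difference quotients at \<open>z0\<close> by
  \<open>3 * h x / r\<close>, so dominated convergence differentiates under the integral
  sign.\<close>

lemma holomorphic_on_integral:
  fixes f :: "complex \<Rightarrow> 'a \<Rightarrow> complex"
  assumes "open S"
    and meas: "\<And>z. z \<in> S \<Longrightarrow> f z \<in> borel_measurable M"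
    and holo: "\<And>x. (\<lambda>z. f z x) holomorphic_on S"
    and dom: "\<And>z0. z0 \<in> S \<Longrightarrow> \<exists>r>0. \<exists>h. integrable M h \<and> ball z0 r \<subseteq> S \<and>
                 (AE x in M. \<forall>z\<in>ball z0 r. norm (f z x) \<le> h x)"
  shows "(\<lambda>z. integral\<^sup>L M (f z)) holomorphic_on S"
proof (rule holomorphic_onI)
  fix z0 assume z0: "z0 \<in> S"
  from dom[OF z0] obtain r h where r: "r > 0" and h: "integrable M h" and sub: "ball z0 r \<subseteq> S"
    and bd: "AE x in M. \<forall>z\<in>ball z0 r. norm (f z x) \<le> h x" by blast
  have int: "integrable M (f z)" if "z \<in> ball z0 r" for z
  proof (rule Bochner_Integration.integrable_bound[OF h])
    show "AE x in M. norm (f z x) \<le> norm (h x)"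
      using bd by eventually_elim (use that in fastforce)
  qed (use that meas sub in auto)
  define D where "D = (\<lambda>x. deriv (\<lambda>z. f z x) z0)"
  have deriv: "((\<lambda>z. f z x) has_field_derivative D x) (at z0)" for x
    unfolding D_def by (rule holomorphic_derivI[OF holo \<open>open S\<close> z0])
  have "((\<lambda>z. integral\<^sup>L M (f z)) has_field_derivative integral\<^sup>L M D) (at z0)"
    unfolding has_field_derivative_iff tendsto_at_iff_sequentially
  proof (intro allI impI)
    fix X :: "nat \<Rightarrow> complex" assume X: "\<forall>i. X i \<in> UNIV - {z0}" and lim: "X \<longlonglongrightarrow> z0"
    have "\<forall>\<^sub>F i in sequentially. X i \<in> ball z0 (r / 3)"
      using lim r by (intro topological_tendstoD) auto
    then obtain N where N: "\<And>i. i \<ge> N \<Longrightarrow> X i \<in> ball z0 (r / 3)"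
      by (auto simp: eventually_sequentially)
    \<comment> \<open>The shift by \<open>N\<close> puts every term into the ball where the
      Lipschitz bound holds, since domination is required for all indices.\<close>
    define Q where "Q = (\<lambda>i x. (f (X (i + N)) x - f z0 x) / (X (i + N) - z0))"
    have ball: "X (i + N) \<in> ball z0 (r / 3)" "X (i + N) \<in> ball z0 r" for i
      using N[of "i + N"] r by auto
    have Q_meas [measurable]: "Q i \<in> borel_measurable M" for i
      unfolding Q_def using meas[OF z0] meas[OF subsetD[OF sub ball(2)]] by measurable
    have "filterlim (\<lambda>i. X (i + N)) (at z0) sequentially"
      using X LIMSEQ_ignore_initial_segment[OF lim, of N] by (simp add: filterlim_at)
    then have Q_lim: "(\<lambda>i. Q i x) \<longlonglongrightarrow> D x" for x
      unfolding Q_def by (rule filterlim_compose[OF deriv[of x, unfolded has_field_derivative_iff]])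
    have "(\<lambda>i. integral\<^sup>L M (Q i)) \<longlonglongrightarrow> integral\<^sup>L M D"
    proof (rule integral_dominated_convergence[where w = "\<lambda>x. 3 * h x / r"])
      show "D \<in> borel_measurable M"
        by (rule borel_measurable_LIMSEQ_metric[OF Q_meas Q_lim])
      show "AE x in M. norm (Q i x) \<le> 3 * h x / r" for i
        using bd
      proof eventually_elim
        case (elim x)
        have "norm (f (X (i + N)) x - f z0 x) \<le> (3 * h x / r) * norm (X (i + N) - z0)"
          using elim holo sub r ball
          by (intro holomorphic_lipschitz_of_bounded) (auto intro: holomorphic_on_subset)
        then show ?case
          using X by (simp add: Q_def norm_divide divide_le_eq)
      qed
    qed (use h Q_lim in auto)
    moreover have "integral\<^sup>L M (Q i) =
        (integral\<^sup>L M (f (X (i + N))) - integral\<^sup>L M (f z0)) / (X (i + N) - z0)" for i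
      using int[OF ball(2)] int[of z0] r unfolding Q_def by simp
    ultimately have "(\<lambda>i. (integral\<^sup>L M (f (X (i + N))) - integral\<^sup>L M (f z0)) / (X (i + N) - z0))
        \<longlonglongrightarrow> integral\<^sup>L M D" by simp
    then show "((\<lambda>z. (integral\<^sup>L M (f z) - integral\<^sup>L M (f z0)) / (z - z0)) \<circ> X)
        \<longlonglongrightarrow> integral\<^sup>L M D"
      unfolding comp_def by (rule LIMSEQ_offset)
  qed
  then show "(\<lambda>z. integral\<^sup>L M (f z)) field_differentiable at z0 within S"
    unfolding field_differentiable_def by (meson has_field_derivative_at_within)
qed

section \<open>The integrable majorant with a singularity at 0\<close>

text \<open>The odd antiderivative of \<open>1 / sqrt \<bar>t\<bar>\<close> that is continuous
  across 0.\<close>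

definition sqrt_primitive :: "real \<Rightarrow> real" where
  "sqrt_primitive t = 2 * sgn t * sqrt \<bar>t\<bar>"

lemma has_bochner_integral_inverse_sqrt_abs:
  assumes "a \<le> b"
  shows "has_bochner_integral lborel (\<lambda>t. indicator {a<..<b} t * (1 / sqrt \<bar>t\<bar>))
           (sqrt_primitive b - sqrt_primitive a)"
proof -
  have "((\<lambda>t. 1 / sqrt \<bar>t\<bar>) has_integral (sqrt_primitive b - sqrt_primitive a)) {a..b}"
  proof (rule fundamental_theorem_of_calculus_interior_strong[where S = "{0}"])
    fix x assume "x \<in> {a<..<b} - {0}"
    then consider "x > 0" | "x < 0" by fastforce
    then have "(sqrt_primitive has_real_derivative 1 / sqrt \<bar>x\<bar>) (at x)"
    proof cases
      case 1
      have "((\<lambda>t. 2 * sqrt t) has_real_derivative 1 / sqrt \<bar>x\<bar>) (at x)"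
        using 1 by (auto intro!: derivative_eq_intros simp: field_simps)
      then show ?thesis
        by (rule has_field_derivative_transform_within_open[where S = "{0<..}"])
           (use 1 in \<open>auto simp: sqrt_primitive_def\<close>)
    next
      case 2
      have "((\<lambda>t. - 2 * sqrt (- t)) has_real_derivative 1 / sqrt \<bar>x\<bar>) (at x)"
        using 2 by (auto intro!: derivative_eq_intros simp: field_simps)
      then show ?thesis
        by (rule has_field_derivative_transform_within_open[where S = "{..<0}"])
           (use 2 in \<open>auto simp: sqrt_primitive_def\<close>)
    qed
    then show "(sqrt_primitive has_vector_derivative 1 / sqrt \<bar>x\<bar>) (at x)"
      by (simp add: has_real_derivative_iff_has_vector_derivative)
  next
    \<comment> \<open>\<open>sgn\<close> jumps at 0; in this form every constituent is
      continuous.\<close>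
    have eq: "sqrt_primitive = (\<lambda>t. 2 * (root 2 (max 0 t) - root 2 (max 0 (- t))))"
      by (auto simp: sqrt_primitive_def sqrt_def max_def sgn_if)
    show "continuous_on {a..b} sqrt_primitive"
      unfolding eq by (intro continuous_intros)
  qed (use assms in auto)
  then have *: "((\<lambda>t. 1 / sqrt \<bar>t\<bar>) has_integral (sqrt_primitive b - sqrt_primitive a)) {a<..<b}"
    by (simp add: has_integral_Icc_iff_Ioo)
  show ?thesis
  proof (rule has_bochner_integral_nn_integral)
    show "(\<integral>\<^sup>+ t. ennreal (indicator {a<..<b} t * (1 / sqrt \<bar>t\<bar>)) \<partial>lborel) =
        ennreal (sqrt_primitive b - sqrt_primitive a)"
      by (rule nn_integral_has_integral_lebesgue[OF _ *]) auto
    show "0 \<le> sqrt_primitive b - sqrt_primitive a"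
      by (rule has_integral_nonneg[OF *]) auto
  qed auto
qed

lemma sqrt_primitive_mono: "a \<le> b \<Longrightarrow> sqrt_primitive a \<le> sqrt_primitive b"
  by (auto simp: sqrt_primitive_def sgn_if intro: order_trans[of _ 0])

text \<open>This says that the mean of \<open>1 / sqrt \<bar>t\<bar>\<close> between
  \<open>c\<close> and \<open>u\<close> is at most \<open>3 / sqrt \<bar>u\<bar>\<close>. For equal
  signs \<open>x - y\<close> factors through the square roots (\<open>key\<close>); for opposite
  signs the inequality of the arithmetic and geometric means gives the constant 3
  (\<open>key2\<close>).\<close>

lemma sqrt_mult_sqrt_primitive_diff:
  "sqrt \<bar>u\<bar> * \<bar>sqrt_primitive u - sqrt_primitive c\<bar> \<le> 3 * \<bar>u - c\<bar>"
proof -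
  have key: "sqrt x * \<bar>2 * sqrt x - 2 * sqrt y\<bar> \<le> 3 * \<bar>x - y\<bar>" if "x \<ge> 0" "y \<ge> 0" for x y :: real
  proof -
    have "sqrt x * \<bar>2 * sqrt x - 2 * sqrt y\<bar> = 2 * (sqrt x * \<bar>sqrt x - sqrt y\<bar>)"
      by (simp add: abs_if algebra_simps)
    also have "\<dots> \<le> 2 * ((sqrt x + sqrt y) * \<bar>sqrt x - sqrt y\<bar>)"
      using that by (intro mult_left_mono mult_right_mono) auto
    also have "(sqrt x + sqrt y) * \<bar>sqrt x - sqrt y\<bar> = \<bar>(sqrt x + sqrt y) * (sqrt x - sqrt y)\<bar>"
      using that by (simp add: abs_mult)
    also have "(sqrt x + sqrt y) * (sqrt x - sqrt y) = x - y"
      using that by (simp add: algebra_simps)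
    also have "2 * \<bar>x - y\<bar> \<le> 3 * \<bar>x - y\<bar>" by simp
    finally show ?thesis .
  qed
  have key2: "sqrt x * (2 * sqrt x + 2 * sqrt y) \<le> 3 * (x + y)" if "x \<ge> 0" "y \<ge> 0" for x y :: real
  proof -
    have "0 \<le> (sqrt x - sqrt y)\<^sup>2" by simp
    then have "2 * (sqrt x * sqrt y) \<le> x + y"
      using that by (simp add: power2_eq_square algebra_simps)
    then have "2 * x + 2 * (sqrt x * sqrt y) \<le> 3 * (x + y)"
      using that by simp
    moreover have "sqrt x * (2 * sqrt x + 2 * sqrt y) = 2 * x + 2 * (sqrt x * sqrt y)"
      using that by (simp add: algebra_simps)
    ultimately show ?thesis by simp
  qed
  consider "u \<ge> 0" "c \<ge> 0" | "u \<le> 0" "c \<le> 0" | "u > 0" "c < 0" | "u < 0" "c > 0" by linarith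
  then show ?thesis
  proof cases
    case 1 then show ?thesis using key[of u c] by (auto simp: sqrt_primitive_def sgn_if)
  next
    case 2 then show ?thesis using key[of "- u" "- c"] by (auto simp: sqrt_primitive_def sgn_if abs_minus_commute)
  next
    case 3 then show ?thesis using key2[of u "- c"] by (simp add: sqrt_primitive_def)
  next
    case 4
    then have "sqrt_primitive u - sqrt_primitive c = - (2 * sqrt (- u) + 2 * sqrt c)"
      by (simp add: sqrt_primitive_def)
    then have "\<bar>sqrt_primitive u - sqrt_primitive c\<bar> = 2 * sqrt (- u) + 2 * sqrt c"
      using 4 by (simp only: abs_minus_cancel) simp
    with 4 key2[of "- u" c] show ?thesis by simp
  qed
qed

section \<open>Measurability and bounds for oriented integrals\<close>

lemma interval_integral_eq_sgn_mult:
  fixes f :: "real \<Rightarrow> complex"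
  shows "(LBINT t=ereal c..ereal u. f t) =
           of_real (sgn (u - c)) * (LBINT t:{min c u<..<max c u}. f t)"
  by (simp add: interval_lebesgue_integral_def sgn_if min_def max_def set_lebesgue_integral_def)

lemma borel_measurable_interval_integral:
  fixes f :: "real \<Rightarrow> complex"
  assumes [measurable]: "f \<in> borel_measurable borel"
  shows "(\<lambda>u. LBINT t=ereal c..ereal u. f t) \<in> borel_measurable borel"
proof -
  \<comment> \<open>The integral is taken over the whole line, with an integrand jointly measurable
    in \<open>u\<close> and \<open>t\<close>.\<close>
  have "(\<lambda>u. LBINT t=ereal c..ereal u. f t) =
     (\<lambda>u. of_real (sgn (u - c)) * (\<integral>t. (if min c u < t \<and> t < max c u then f t else 0) \<partial>lborel))"
    unfolding interval_integral_eq_sgn_mult set_lebesgue_integral_def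
    by (intro ext arg_cong2[where f = "(*)"] refl Bochner_Integration.integral_cong)
       (auto simp: indicator_def)
  also have "\<dots> \<in> borel_measurable borel"
    by measurable
  finally show ?thesis .
qed

text \<open>Serves two majorants: a constant, and a multiple of
  \<open>1 / sqrt \<bar>t\<bar>\<close>, for which the point 0 must be exempt.\<close>

lemma norm_interval_integral_le_integral:
  fixes f :: "real \<Rightarrow> complex" and h :: "real \<Rightarrow> real"
  assumes [measurable]: "f \<in> borel_measurable borel"
    and h: "has_bochner_integral lborel (\<lambda>t. indicator {min c u<..<max c u} t * h t) I"
    and bound: "AE t in lborel. t \<in> {min c u<..<max c u} \<longrightarrow> norm (f t) \<le> h t"
  shows "norm (LBINT t=ereal c..ereal u. f t) \<le> I"
proof -
  let ?A = "{min c u<..<max c u}"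
  have int: "integrable lborel (\<lambda>t. indicator ?A t * h t)"
    by (rule integrable.intros[OF h])
  have ae: "AE t in lborel. norm (indicator ?A t *\<^sub>R f t) \<le> indicator ?A t * h t"
    using bound by eventually_elim (simp split: split_indicator)
  have "norm (LBINT t=ereal c..ereal u. f t) \<le> norm (LBINT t:?A. f t)"
    unfolding interval_integral_eq_sgn_mult by (simp add: norm_mult sgn_if)
  also have "\<dots> \<le> (\<integral>t. norm (indicator ?A t *\<^sub>R f t) \<partial>lborel)"
    unfolding set_lebesgue_integral_def by (rule integral_norm_bound)
  also have "\<dots> \<le> (\<integral>t. indicator ?A t * h t \<partial>lborel)"
  proof (rule integral_mono_AE[OF _ int ae])
    show "integrable lborel (\<lambda>t. norm (indicator ?A t *\<^sub>R f t))"
    proof (rule Bochner_Integration.integrable_bound[OF int])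
      show "AE t in lborel. norm (norm (indicator ?A t *\<^sub>R f t)) \<le> norm (indicator ?A t * h t)"
        using ae by eventually_elim auto
    qed measurable
  qed
  also have "\<dots> = I"
    by (rule has_bochner_integral_integral_eq[OF h])
  finally show ?thesis .
qed

section \<open>Families stable under averaging\<close>

text \<open>At \<open>u = c\<close> division by zero gives the value 0, not the limit of the means;
  the bounds below survive there because they are nonnegative.\<close>

definition average :: "real \<Rightarrow> (real \<Rightarrow> complex) \<Rightarrow> real \<Rightarrow> complex" where
  "average c g u = (LBINT t=ereal c..ereal u. g t) / of_real (u - c)"

text \<open>All base points and endpoints lie in \<open>[-R, R]\<close>, so only measurability is
  global in \<open>u\<close>. The factor \<open>sqrt \<bar>u\<bar>\<close> stands on the left in
  \<open>singular_bound\<close> to keep the condition meaningful at \<open>u = 0\<close>.\<close>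

locale tame_family =
  fixes R :: real and K :: "complex \<Rightarrow> real" and G :: "complex \<Rightarrow> real \<Rightarrow> complex"
  assumes measurable: "G w \<in> borel_measurable borel"
    and holomorphic: "\<bar>u\<bar> \<le> R \<Longrightarrow> (\<lambda>w. G w u) holomorphic_on {w. Re w > - 1/2}"
    and singular_bound: "\<exists>C. \<forall>w u. Re w > - 1/2 \<longrightarrow> norm w \<le> L \<longrightarrow> \<bar>u\<bar> \<le> R \<longrightarrow>
           sqrt \<bar>u\<bar> * norm (G w u) \<le> C"
    and bound: "\<lbrakk>Re w \<ge> 0; \<bar>u\<bar> \<le> R\<rbrakk> \<Longrightarrow> norm (G w u) \<le> K w"
begin

lemma holomorphic_interval_integral:
  assumes c: "\<bar>c\<bar> \<le> R" and u: "\<bar>u\<bar> \<le> R"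
  shows "(\<lambda>w. LBINT t=ereal c..ereal u. G w t) holomorphic_on {w. Re w > - 1/2}"
  unfolding interval_integral_eq_sgn_mult set_lebesgue_integral_def
proof (intro holomorphic_on_mult holomorphic_on_const holomorphic_on_integral)
  let ?S = "{w. Re w > - 1/2}" and ?A = "{min c u<..<max c u}"
  show "open ?S" by (rule open_halfspace_Re_gt)
  show "(\<lambda>t. indicator ?A t *\<^sub>R G w t) \<in> borel_measurable lborel" for w
    using measurable by measurable
  show "(\<lambda>w. indicator ?A t *\<^sub>R G w t) holomorphic_on ?S" for t
  proof (cases "t \<in> ?A")
    case True
    then have "\<bar>t\<bar> \<le> R" using c u by (auto simp: min_def max_def split: if_splits)
    with True holomorphic show ?thesis by simp
  qed simp
  fix z0 assume "z0 \<in> ?S"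
  then obtain r where r: "r > 0" "ball z0 r \<subseteq> ?S"
    using \<open>open ?S\<close> open_contains_ball by blast
  \<comment> \<open>The radius \<open>norm z0 + r\<close> covers the whole ball, so one constant
    serves all \<open>w\<close> in it.\<close>
  obtain C where C: "\<And>w u. \<lbrakk>Re w > - 1/2; norm w \<le> norm z0 + r; \<bar>u\<bar> \<le> R\<rbrakk> \<Longrightarrow>
      sqrt \<bar>u\<bar> * norm (G w u) \<le> C"
    using singular_bound[of "norm z0 + r"] by blast
  let ?h = "\<lambda>t. C * (indicator ?A t * (1 / sqrt \<bar>t\<bar>))"
  have "integrable lborel ?h"
    by (intro integrable_mult_right
        integrable.intros[OF has_bochner_integral_inverse_sqrt_abs]) simp
  \<comment> \<open>At \<open>t = 0\<close> the majorant has the value 0 by convention and need not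
    dominate.\<close>
  moreover have "AE t in lborel. \<forall>w\<in>ball z0 r. norm (indicator ?A t *\<^sub>R G w t) \<le> ?h t"
    using AE_lborel_singleton[of 0]
  proof eventually_elim
    case (elim t)
    show ?case
    proof
      fix w assume w: "w \<in> ball z0 r"
      then have "w \<in> ?S" using r by blast
      with w have "norm w \<le> norm z0 + r" "Re w > - 1/2"
        using norm_triangle_sub[of w z0] by (auto simp: dist_norm norm_minus_commute)
      moreover have "\<bar>t\<bar> \<le> R" if "t \<in> ?A"
        using c u that by (auto simp: min_def max_def split: if_splits)
      ultimately show "norm (indicator ?A t *\<^sub>R G w t) \<le> ?h t"
        using C[of w t] elim by (simp add: field_simps split: split_indicator)
    qed
  qed
  ultimately show "\<exists>r>0. \<exists>h. integrable lborel h \<and> ball z0 r \<subseteq> ?S \<and>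
      (AE t in lborel. \<forall>w\<in>ball z0 r. norm (indicator ?A t *\<^sub>R G w t) \<le> h t)"
    using r by blast
qed

lemma norm_interval_integral_le:
  assumes "Re w \<ge> 0" and c: "\<bar>c\<bar> \<le> R" and u: "\<bar>u\<bar> \<le> R"
  shows "norm (LBINT t=ereal c..ereal u. G w t) \<le> K w * \<bar>u - c\<bar>"
proof (rule norm_interval_integral_le_integral[OF measurable])
  show "has_bochner_integral lborel (\<lambda>t. indicator {min c u<..<max c u} t * K w) (K w * \<bar>u - c\<bar>)"
    using has_bochner_integral_mult_left
      [OF has_bochner_integral_real_indicator[of "{min c u<..<max c u}" lborel], of "K w"]
    by (simp add: min_def max_def mult.commute abs_if split: if_splits)
  show "AE t in lborel. t \<in> {min c u<..<max c u} \<longrightarrow> norm (G w t) \<le> K w"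
    using bound[OF assms(1)] c u by (intro AE_I2) (auto simp: min_def max_def split: if_splits)
qed

lemma norm_interval_integral_singular_le:
  assumes G: "\<And>v. \<bar>v\<bar> \<le> R \<Longrightarrow> sqrt \<bar>v\<bar> * norm (G w v) \<le> C"
    and c: "\<bar>c\<bar> \<le> R" and u: "\<bar>u\<bar> \<le> R"
  shows "norm (LBINT t=ereal c..ereal u. G w t) \<le> C * \<bar>sqrt_primitive u - sqrt_primitive c\<bar>"
proof (rule norm_interval_integral_le_integral[OF measurable])
  have "\<bar>sqrt_primitive u - sqrt_primitive c\<bar> = sqrt_primitive (max c u) - sqrt_primitive (min c u)"
    using sqrt_primitive_mono[of c u] sqrt_primitive_mono[of u c] by (auto simp: min_def max_def)
  then show "has_bochner_integral lborel (\<lambda>t. indicator {min c u<..<max c u} t * (C * (1 / sqrt \<bar>t\<bar>)))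
      (C * \<bar>sqrt_primitive u - sqrt_primitive c\<bar>)"
    using has_bochner_integral_mult_right[OF has_bochner_integral_inverse_sqrt_abs[of "min c u" "max c u"], of C]
    by (simp add: mult_ac)
  show "AE t in lborel. t \<in> {min c u<..<max c u} \<longrightarrow> norm (G w t) \<le> C * (1 / sqrt \<bar>t\<bar>)"
    using AE_lborel_singleton[of 0]
  proof eventually_elim
    case (elim t)
    have "\<bar>t\<bar> \<le> R" if "t \<in> {min c u<..<max c u}"
      using c u that by (auto simp: min_def max_def split: if_splits)
    with G[of t] elim show ?case by (simp add: field_simps)
  qed
qed

text \<open>Dividing the two integral bounds by \<open>\<bar>u - c\<bar>\<close> reproduces
  \<open>K w\<close> exactly and turns the singular constant \<open>C\<close> into
  \<open>3 * C\<close>.\<close>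

lemma tame_family_average:
  assumes c: "\<bar>c\<bar> \<le> R"
  shows "tame_family R K (\<lambda>w. average c (G w))"
proof
  show "average c (G w) \<in> borel_measurable borel" for w
    unfolding average_def using borel_measurable_interval_integral[OF measurable] by measurable
  show "(\<lambda>w. average c (G w) u) holomorphic_on {w. Re w > - 1/2}" if "\<bar>u\<bar> \<le> R" for u
    using holomorphic_interval_integral[OF c that]
    by (cases "u = c") (auto simp: average_def intro!: holomorphic_intros)
  show "norm (average c (G w) u) \<le> K w" if "Re w \<ge> 0" "\<bar>u\<bar> \<le> R" for w u
  proof (cases "u = c")
    case True
    then show ?thesis using bound[OF that] by (simp add: average_def) (meson norm_ge_zero order_trans)
  next
    case False
    then show ?thesis
      using norm_interval_integral_le[OF that(1) c that(2)]
      by (simp add: average_def norm_divide pos_divide_le_eq flip: of_real_diff)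
  qed
  fix L
  obtain C where C: "\<And>w u. \<lbrakk>Re w > - 1/2; norm w \<le> L; \<bar>u\<bar> \<le> R\<rbrakk> \<Longrightarrow> sqrt \<bar>u\<bar> * norm (G w u) \<le> C"
    using singular_bound[of L] by blast
  have "sqrt \<bar>u\<bar> * norm (average c (G w) u) \<le> 3 * C"
    if w: "Re w > - 1/2" "norm w \<le> L" and u: "\<bar>u\<bar> \<le> R" for w u
  proof -
    have "C \<ge> 0"
      by (rule order_trans[OF _ C[OF w u]]) simp
    have "sqrt \<bar>u\<bar> * norm (LBINT t=ereal c..ereal u. G w t) \<le>
        sqrt \<bar>u\<bar> * (C * \<bar>sqrt_primitive u - sqrt_primitive c\<bar>)"
      using C w c u by (intro mult_left_mono norm_interval_integral_singular_le) auto
    also have "\<dots> = C * (sqrt \<bar>u\<bar> * \<bar>sqrt_primitive u - sqrt_primitive c\<bar>)" by simp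
    also have "\<dots> \<le> C * (3 * \<bar>u - c\<bar>)"
      using \<open>C \<ge> 0\<close> by (intro mult_left_mono sqrt_mult_sqrt_primitive_diff)
    finally show ?thesis
      using \<open>C \<ge> 0\<close> by (cases "u = c")
        (simp_all add: average_def norm_divide pos_divide_le_eq mult_ac flip: of_real_diff)
  qed
  then show "\<exists>C. \<forall>w u. Re w > - 1/2 \<longrightarrow> norm w \<le> L \<longrightarrow> \<bar>u\<bar> \<le> R \<longrightarrow>
      sqrt \<bar>u\<bar> * norm (average c (G w) u) \<le> C" by blast
qed

end

section \<open>Propagation through the recursion\<close>

lemma tame_family_zero:
  assumes "\<And>w. Re w \<ge> 0 \<Longrightarrow> K w \<ge> 0"
  shows "tame_family R K (\<lambda>w u. 0)"
  by standard (use assms in \<open>auto intro!: exI[of _ 0]\<close>)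

lemma tame_family_nested_g:
  assumes start: "tame_family R K (\<lambda>w u. F w u / of_real (u - B))" and "R \<ge> 0"
  shows "tame_family R K (\<lambda>w. nested_g (F w) B i)"
proof (induction i)
  case 0
  \<comment> \<open>Index 0 is the dummy zero function, whose bound only requires \<open>K w\<close>
    to be nonnegative.\<close>
  have "K w \<ge> 0" if "Re w \<ge> 0" for w
    using tame_family.bound[OF start that, of 0] \<open>R \<ge> 0\<close> by (auto intro: order_trans[OF norm_ge_zero])
  then have "tame_family R K (\<lambda>w u. 0)" by (rule tame_family_zero)
  moreover have "(\<lambda>w. nested_g (F w) B 0) = (\<lambda>w u. 0)" by (simp add: fun_eq_iff)
  ultimately show ?case by simp
next
  case (Suc i)
  show ?case
  proof (cases i)
    case 0
    have "(\<lambda>w. nested_g (F w) B (Suc 0)) = (\<lambda>w u. F w u / of_real (u - B))"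
      by (simp add: fun_eq_iff)
    with start 0 show ?thesis by simp
  next
    case (Suc i')
    have "(\<lambda>w. nested_g (F w) B (Suc i)) = (\<lambda>w. average 0 (nested_g (F w) B i))"
      by (simp add: fun_eq_iff average_def Suc)
    with tame_family.tame_family_average[OF Suc.IH, of 0] \<open>R \<ge> 0\<close> show ?thesis by simp
  qed
qed

text \<open>The induction runs over the quotients: for \<open>Suc j\<close> the quotient is the
  average of the last \<open>nested_g\<close> based at \<open>bprod b (Suc j)\<close>. The 1 in
  \<open>start\<close> is the empty product \<open>bprod b 0\<close>.\<close>

lemma tame_family_nested_F:
  assumes start: "tame_family R K (\<lambda>w u. F w u / of_real (u - 1))"
    and "\<And>i. i \<le> j \<Longrightarrow> \<bar>bprod b i\<bar> \<le> R" and "R \<ge> 0"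
  shows "tame_family R K (\<lambda>w u. nested_F (F w) m b j u / of_real (u - bprod b j))"
  using assms(2)
proof (induction j)
  case 0
  with start show ?case by (simp add: bprod_def)
next
  case (Suc j)
  have "tame_family R K (\<lambda>w. nested_g (nested_F (F w) m b j) (bprod b j) (m (Suc j)))"
    using Suc by (intro tame_family_nested_g) (auto simp: \<open>R \<ge> 0\<close>)
  from tame_family.tame_family_average[OF this Suc.prems[OF order_refl]] show ?case
    by (simp add: average_def[abs_def] del: of_real_diff)
qed

section \<open>Estimates for the starting quotient\<close>

text \<open>The values 1 and -1 of \<open>\<sigma>\<close> give the even and the odd power.\<close>

definition signed_powr :: "real \<Rightarrow> real \<Rightarrow> complex \<Rightarrow> complex" where
  "signed_powr \<sigma> x w = (if x > 0 then of_real x powr w else of_real \<sigma> * of_real (- x) powr w)"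

lemma signed_powr_exp:
  "signed_powr \<sigma> x w =
     (if x > 0 then exp (w * of_real (ln x))
      else if x < 0 then of_real \<sigma> * exp (w * of_real (ln (- x))) else 0)"
  using Ln_of_real[of "- x"] by (auto simp: signed_powr_def powr_def Ln_of_real)

text \<open>The base of the complex power is positive for either sign of \<open>x\<close>, so the
  modulus does not see \<open>Im w\<close>. The principal branch at negative \<open>x\<close> would
  add a factor \<open>exp (- pi * Im w)\<close>.\<close>

lemma norm_signed_powr_le:
  assumes "\<bar>\<sigma>\<bar> \<le> 1"
  shows "norm (signed_powr \<sigma> x w) \<le> \<bar>x\<bar> powr Re w"
proof -
  have "\<bar>\<sigma>\<bar> * exp (ln (- x) * Re w) \<le> 1 * exp (ln (- x) * Re w)"
    using assms by (intro mult_right_mono) auto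
  then show ?thesis
    by (auto simp: signed_powr_exp powr_def norm_mult mult.commute)
qed

lemma norm_exp_minus_one_le:
  fixes z :: complex
  shows "norm (exp z - 1) \<le> norm z * exp (norm z)"
proof -
  have "norm (exp z - exp 0) \<le> exp (norm z) * norm (z - 0)"
  proof (rule field_differentiable_bound[where S = "cball 0 (norm z)" and f' = exp])
    fix x :: complex assume "x \<in> cball 0 (norm z)"
    then show "norm (exp x) \<le> exp (norm z)"
      using norm_exp[of x] by (auto intro: order_trans)
  qed (auto intro: DERIV_subset[OF DERIV_exp])
  then show ?thesis by (simp add: mult.commute)
qed

text \<open>Here \<open>\<bar>ln u\<bar>\<close> is at most \<open>2 * \<bar>u - 1\<bar>\<close>,
  which cancels the denominator, and at most 1, which bounds the exponential. The exponent
  \<open>3/2\<close> has to stay below \<open>pi / 2\<close>, since \<open>w\<close> will be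
  \<open>2 * z + d\<close>.\<close>

lemma norm_signed_powr_quotient_near_1:
  assumes "\<bar>u - 1\<bar> \<le> 1/2"
  shows "norm ((signed_powr \<sigma> u w - 1) / of_real (u - 1)) \<le> 4 * exp (3/2 * norm w)"
proof (cases "u = 1")
  case False
  have "\<bar>ln (1 + (u - 1)) - (u - 1)\<bar> \<le> 2 * (u - 1)\<^sup>2"
    using assms by (intro abs_ln_one_plus_x_minus_x_bound)
  moreover have "2 * (u - 1)\<^sup>2 \<le> \<bar>u - 1\<bar>"
    using mult_right_mono[OF assms, of "\<bar>u - 1\<bar>"] by (simp add: power2_eq_square flip: abs_mult)
  ultimately have "\<bar>ln (1 + (u - 1)) - (u - 1)\<bar> \<le> \<bar>u - 1\<bar>" by (rule order_trans)
  then have ln: "\<bar>ln u\<bar> \<le> 2 * \<bar>u - 1\<bar>"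
    using abs_triangle_ineq[of "ln u - (u - 1)" "u - 1"] by simp
  then have ln1: "\<bar>ln u\<bar> \<le> 1" by (rule order_trans) (use assms in simp)
  have "u > 0" using assms by linarith
  then have "norm (signed_powr \<sigma> u w - 1) = norm (exp (w * of_real (ln u)) - 1)"
    by (simp add: signed_powr_exp)
  also have "\<dots> \<le> norm w * \<bar>ln u\<bar> * exp (norm w * \<bar>ln u\<bar>)"
    using norm_exp_minus_one_le[of "w * of_real (ln u)"] by (simp add: norm_mult)
  also have "\<dots> \<le> norm w * (2 * \<bar>u - 1\<bar>) * exp (norm w * 1)"
    using ln ln1 by (intro mult_mono) (auto intro: mult_left_mono mult_left_le)
  also have "\<dots> = (2 * norm w) * exp (norm w) * \<bar>u - 1\<bar>" by simp
  also have "\<dots> \<le> 4 * exp (3/2 * norm w) * \<bar>u - 1\<bar>"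
  proof (rule mult_right_mono)
    \<comment> \<open>The linear factor is absorbed at the cost of \<open>1/2\<close> in the
      exponent.\<close>
    have "2 * norm w \<le> 4 * exp (norm w / 2)"
      using exp_ge_add_one_self[of "norm w / 2"] by linarith
    then have "2 * norm w * exp (norm w) \<le> 4 * exp (norm w / 2) * exp (norm w)"
      by (rule mult_right_mono) simp
    also have "\<dots> = 4 * exp (3/2 * norm w)"
      by (simp add: mult.assoc flip: exp_add)
    finally show "2 * norm w * exp (norm w) \<le> 4 * exp (3/2 * norm w)" .
  qed simp
  finally show ?thesis
    using False by (simp add: norm_divide pos_divide_le_eq del: of_real_diff)
qed simp

lemma norm_signed_powr_quotient_far:
  assumes "\<bar>\<sigma>\<bar> \<le> 1" "\<bar>u - 1\<bar> \<ge> 1/2"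
  shows "norm ((signed_powr \<sigma> u w - 1) / of_real (u - 1)) \<le> 2 * (\<bar>u\<bar> powr Re w + 1)"
proof -
  have "norm (signed_powr \<sigma> u w - 1) \<le> \<bar>u\<bar> powr Re w + 1"
    using norm_signed_powr_le[OF assms(1), of u w] norm_triangle_ineq4[of "signed_powr \<sigma> u w" 1] by simp
  also have "\<dots> \<le> (\<bar>u\<bar> powr Re w + 1) * (2 * \<bar>u - 1\<bar>)"
    using assms(2) mult_left_mono[of 1 "2 * \<bar>u - 1\<bar>" "\<bar>u\<bar> powr Re w + 1"] by simp
  also have "\<dots> = 2 * (\<bar>u\<bar> powr Re w + 1) * \<bar>u - 1\<bar>" by (simp only: mult_ac)
  finally have "norm (signed_powr \<sigma> u w - 1) \<le> 2 * (\<bar>u\<bar> powr Re w + 1) * \<bar>u - 1\<bar>" .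
  moreover have "u \<noteq> 1" using assms(2) by auto
  ultimately show ?thesis
    by (simp add: norm_divide pos_divide_le_eq del: of_real_diff)
qed

text \<open>At \<open>w = 2\<i>y + d\<close> the first term grows like \<open>exp (3\<bar>y\<bar>)\<close> and the second is constant; \<open>3 < \<pi>\<close>.\<close>

definition growth :: "real \<Rightarrow> complex \<Rightarrow> real" where
  "growth R w = 4 * exp (3/2 * norm w) + 4 * R powr Re w"

text \<open>Both bounds split at \<open>\<bar>u - 1\<bar> = 1/2\<close>: the removable singularity
  at 1 lies in the near part, the possible singularity at 0 in the far part.\<close>

lemma tame_family_signed_powr_quotient:
  assumes R: "R \<ge> 1" and \<sigma>: "\<bar>\<sigma>\<bar> \<le> 1"
  shows "tame_family R (growth R) (\<lambda>w u. (signed_powr \<sigma> u w - 1) / of_real (u - 1))"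
    (is "tame_family _ _ ?G")
proof
  show "?G w \<in> borel_measurable borel" for w
    unfolding signed_powr_exp by measurable
  show "(\<lambda>w. ?G w u) holomorphic_on {w. Re w > - 1/2}" for u
    by (cases "u = 1"; cases "u > 0"; cases "u < 0") (auto simp: signed_powr_exp intro!: holomorphic_intros)
  show "norm (?G w u) \<le> growth R w" if w: "Re w \<ge> 0" and u: "\<bar>u\<bar> \<le> R" for w u
  proof (cases "\<bar>u - 1\<bar> \<le> 1/2")
    case True
    show ?thesis
      using norm_signed_powr_quotient_near_1[OF True, of \<sigma> w] by (simp add: growth_def add_increasing2)
  next
    case False
    have "norm (?G w u) \<le> 2 * (\<bar>u\<bar> powr Re w + 1)"
      using False by (intro norm_signed_powr_quotient_far[OF \<sigma>]) simp
    also have "\<dots> \<le> 2 * (R powr Re w + R powr Re w)"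
      using R u w by (intro mult_left_mono add_mono powr_mono2 ge_one_powr_ge_zero) auto
    also have "\<dots> \<le> growth R w" by (simp add: growth_def)
    finally show ?thesis .
  qed
  fix L
  let ?C1 = "sqrt R * (4 * exp (3/2 * L))" and ?C2 = "2 * (R powr (L + 1/2) + sqrt R)"
  have "sqrt \<bar>u\<bar> * norm (?G w u) \<le> ?C1 + ?C2"
    if w: "Re w > - 1/2" "norm w \<le> L" and u: "\<bar>u\<bar> \<le> R" for w u
  proof (cases "\<bar>u - 1\<bar> \<le> 1/2")
    case True
    have "norm (?G w u) \<le> 4 * exp (3/2 * norm w)"
      by (rule norm_signed_powr_quotient_near_1[OF True])
    also have "\<dots> \<le> 4 * exp (3/2 * L)" using w by simp
    finally have "sqrt \<bar>u\<bar> * norm (?G w u) \<le> ?C1"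
      using u by (intro mult_mono) auto
    moreover have "?C2 \<ge> 0" using R by simp
    ultimately show ?thesis by linarith
  next
    case False
    have "sqrt \<bar>u\<bar> * norm (?G w u) \<le> sqrt \<bar>u\<bar> * (2 * (\<bar>u\<bar> powr Re w + 1))"
      using False by (intro mult_left_mono norm_signed_powr_quotient_far[OF \<sigma>]) auto
    also have "\<dots> = 2 * (\<bar>u\<bar> powr (Re w + 1/2) + sqrt \<bar>u\<bar>)"
      by (simp add: powr_add powr_half_sqrt algebra_simps)
    \<comment> \<open>The exponent is positive because \<open>Re w > - 1/2\<close>, so the power
      increases with the base and stays bounded near \<open>u = 0\<close>.\<close>
    also have "\<bar>u\<bar> powr (Re w + 1/2) \<le> R powr (Re w + 1/2)"
      using u w by (intro powr_mono2) auto
    also have "\<dots> \<le> R powr (L + 1/2)"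
      using R w abs_Re_le_cmod[of w] by (intro powr_mono) auto
    also have "sqrt \<bar>u\<bar> \<le> sqrt R" using u by simp
    finally have "sqrt \<bar>u\<bar> * norm (?G w u) \<le> ?C2" by simp
    moreover have "?C1 \<ge> 0" using R by simp
    ultimately show ?thesis by linarith
  qed
  then show "\<exists>C. \<forall>w u. Re w > - 1/2 \<longrightarrow> norm w \<le> L \<longrightarrow> \<bar>u\<bar> \<le> R \<longrightarrow> sqrt \<bar>u\<bar> * norm (?G w u) \<le> C"
    by blast
qed

section \<open>Growth of the nested integral and Carlson type\<close>

lemma nested_integral_signed_powr:
  assumes "k \<ge> 1" and \<sigma>: "\<bar>\<sigma>\<bar> \<le> 1"
  obtains R where "R \<ge> 1"
    and "(\<lambda>w. nested_integral (\<lambda>x. signed_powr \<sigma> x w - 1) k m b) holomorphic_on {w. Re w > - 1/2}"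
    and "\<And>w. Re w \<ge> 0 \<Longrightarrow> norm (nested_integral (\<lambda>x. signed_powr \<sigma> x w - 1) k m b) \<le> growth R w * R"
proof
  \<comment> \<open>The sum dominates every partial product, and the summand 1 ensures
    \<open>R \<ge> 1\<close>.\<close>
  define R where "R = 1 + (\<Sum>i\<le>k. \<bar>bprod b i\<bar>)"
  define F where "F = (\<lambda>w x. signed_powr \<sigma> x w - 1)"
  show R: "R \<ge> 1" unfolding R_def by (simp add: sum_nonneg)
  have B: "\<bar>bprod b i\<bar> \<le> R" if "i \<le> k" for i
    using member_le_sum[of i "{..k}" "\<lambda>i. \<bar>bprod b i\<bar>"] that unfolding R_def by simp
  interpret tame_family R "growth R"
    "\<lambda>w. nested_g (nested_F (F w) m b (k - 1)) (bprod b (k - 1)) (m k)"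
    using R B tame_family_signed_powr_quotient[OF R \<sigma>]
    by (intro tame_family_nested_g tame_family_nested_F) (auto simp: F_def)
  show "(\<lambda>w. nested_integral (\<lambda>x. signed_powr \<sigma> x w - 1) k m b) holomorphic_on {w. Re w > - 1/2}"
    using holomorphic_interval_integral[of 0 "bprod b k"] R B[of k]
    unfolding nested_integral_def F_def by simp
  show "norm (nested_integral (\<lambda>x. signed_powr \<sigma> x w - 1) k m b) \<le> growth R w * R" if "Re w \<ge> 0" for w
  proof -
    have "norm (nested_integral (\<lambda>x. signed_powr \<sigma> x w - 1) k m b) \<le> growth R w * \<bar>bprod b k - 0\<bar>"
      using norm_interval_integral_le[OF that, of 0 "bprod b k"] R B[of k]
      unfolding nested_integral_def F_def by simp
    also have "\<dots> \<le> growth R w * R"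
      using B[of k] by (intro mult_left_mono) (auto simp: growth_def)
    finally show ?thesis .
  qed
qed

lemma carlson_type_nested_integral:
  assumes "k \<ge> 1" and "\<bar>\<sigma>\<bar> \<le> 1" and d: "d \<ge> 0"
  shows "carlson_type (\<lambda>z. nested_integral (\<lambda>x. signed_powr \<sigma> x (2 * z + of_real d) - 1) k m b)"
proof -
  define f where "f = (\<lambda>w. nested_integral (\<lambda>x. signed_powr \<sigma> x w - 1) k m b)"
  obtain R where R: "R \<ge> 1" and holo: "f holomorphic_on {w. Re w > - 1/2}"
    and bound: "\<And>w. Re w \<ge> 0 \<Longrightarrow> norm (f w) \<le> growth R w * R"
    using nested_integral_signed_powr[OF assms(1,2)] unfolding f_def by metis
  define C where "C = (4 * exp (3/2 * d) + 4 * R powr d) * R"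
  have C: "C > 0" using R unfolding C_def by (intro mult_pos_pos add_pos_pos) auto
  \<comment> \<open>As \<open>d \<ge> 0\<close>, the substitution maps \<open>Re z > - 1/4\<close>
    into \<open>Re w > - 1/2\<close>.\<close>
  have "(f \<circ> (\<lambda>z. 2 * z + of_real d)) holomorphic_on {z. Re z > - 1/4}"
    using d by (intro holomorphic_on_compose_gen[OF _ holo] holomorphic_intros) auto
  then have an: "(\<lambda>z. f (2 * z + of_real d)) analytic_on {z. Re z \<ge> 0}"
    unfolding comp_def
    by (subst (asm) analytic_on_open[symmetric, OF open_halfspace_Re_gt]) (auto elim: analytic_on_subset)
  \<comment> \<open>One estimate for both growth conditions: \<open>c = 3 + 2 * ln R\<close> works
    on the half plane, and \<open>c = 3\<close> on the imaginary axis, where the term with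
    \<open>Re z\<close> vanishes.\<close>
  have main: "norm (f (2 * z + of_real d)) \<le> C * exp (c * norm z)"
    if z: "Re z \<ge> 0" and c: "c \<ge> 3" "2 * ln R * Re z \<le> c * norm z" for z c
  proof -
    have "norm (2 * z + of_real d) \<le> 2 * norm z + d"
      using norm_triangle_ineq[of "2 * z" "of_real d"] d by (simp add: norm_mult)
    moreover have "3 * norm z \<le> c * norm z" using c by (intro mult_right_mono) auto
    ultimately have "3/2 * norm (2 * z + of_real d) \<le> 3/2 * d + c * norm z" by argo
    then have 1: "exp (3/2 * norm (2 * z + of_real d)) \<le> exp (3/2 * d) * exp (c * norm z)"
      by (simp flip: exp_add)
    have "R powr Re (2 * z + of_real d) = R powr d * exp (2 * ln R * Re z)"
      using R by (simp add: powr_def algebra_simps flip: exp_add)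
    also have "\<dots> \<le> R powr d * exp (c * norm z)" using c by (intro mult_left_mono) auto
    finally have 2: "R powr Re (2 * z + of_real d) \<le> R powr d * exp (c * norm z)" .
    have "norm (f (2 * z + of_real d)) \<le> growth R (2 * z + of_real d) * R"
      using z d by (intro bound) simp
    also have "\<dots> \<le> ((4 * exp (3/2 * d) + 4 * R powr d) * exp (c * norm z)) * R"
      unfolding growth_def using 1 2 R by (intro mult_right_mono) (auto simp: distrib_right)
    finally show ?thesis by (simp add: C_def mult_ac)
  qed
  have "norm (f (2 * z + of_real d)) \<le> C * exp ((3 + 2 * ln R) * norm z)" if "Re z \<ge> 0" for z
  proof (rule main[OF that])
    have "2 * ln R * Re z \<le> 2 * ln R * norm z"
      using R abs_Re_le_cmod[of z] by (intro mult_left_mono) auto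
    then show "2 * ln R * Re z \<le> (3 + 2 * ln R) * norm z"
      by (simp add: distrib_right add_increasing)
  qed (use R in auto)
  then have "\<exists>c C. c > 0 \<and> C > 0 \<and> (\<forall>z. Re z \<ge> 0 \<longrightarrow> norm (f (2 * z + of_real d)) \<le> C * exp (c * norm z))"
    using C R by (intro exI[of _ "3 + 2 * ln R"] exI[of _ C]) (auto intro: add_pos_nonneg)
  moreover have "norm (f (2 * (\<i> * of_real y) + of_real d)) \<le> C * exp (3 * \<bar>y\<bar>)" for y :: real
    using main[of "\<i> * of_real y" 3] by (simp add: norm_mult)
  then have "\<exists>c C. c > 0 \<and> C > 0 \<and> c < pi \<and>
      (\<forall>y::real. norm (f (2 * (\<i> * of_real y) + of_real d)) \<le> C * exp (c * \<bar>y\<bar>))"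
    using C pi_gt3 by (intro exI[of _ 3] exI[of _ C]) auto
  ultimately show ?thesis
    using an unfolding carlson_type_def f_def by blast
qed

theorem proposition6p4:
  fixes k :: nat and m :: "nat \<Rightarrow> nat" and b :: "nat \<Rightarrow> real"
  assumes "k \<ge> 1"
    and "\<And>j. j \<in> {1..k} \<Longrightarrow> m j \<ge> 1"
    and "\<And>j. j \<in> {1..k} \<Longrightarrow> b j \<noteq> 0"
  shows "carlson_type (I_even k m b) \<and> carlson_type (I_odd k m b)"
proof -
  have "even_powr = signed_powr 1" "odd_powr = signed_powr (- 1)"
    by (simp_all add: fun_eq_iff even_powr_def odd_powr_def signed_powr_def)
  then have eq: "I_even k m b = (\<lambda>z. nested_integral (\<lambda>x. signed_powr 1 x (2 * z + of_real 0) - 1) k m b)"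
      "I_odd k m b = (\<lambda>z. nested_integral (\<lambda>x. signed_powr (- 1) x (2 * z + of_real 1) - 1) k m b)"
    by (simp_all add: fun_eq_iff I_even_def I_odd_def)
  show ?thesis
    unfolding eq by (intro conjI carlson_type_nested_integral[OF \<open>k \<ge> 1\<close>]) auto
qed

end
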